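(* For any (right) nearring $N$, either $\operatorname{SIG}(N)$ is a star graph or the girth of $\operatorname{SIG}(N)$ is $3$.
   Context: A right nearring $(N,+,\cdot)$ consists of a (not necessarily abelian) group $(N,+)$ and a semigroup $(N,\cdot)$ with $(a+b)c=ac+bc$ for all $a,b,c\in N$. An ideal of $N$ is a normal subgroup $I$ of $(N,+)$ with $IN\subseteq I$ and $n(n'+i)-nn'\in I$ for all $n,n'\in N$, $i\in I$. An ideal $I$ is a supplement of an ideal $K$ if $I$ is minimal (among ideals) with respect to $K+I=N$; a supplement (ideal) is an ideal that is a supplement of some ideal. The supplement ideal graph $\operatorname{SIG}(N)$ is the simple undirected graph whose vertices are all ideals of $N$ (including $\{0\}$ and $N$), two distinct ideals $I,J$ being adjacent if and only if $I\cap J$ is a supplement ideal of $N$. The girth is the length of a shortest cycle. A star graph is a graph with a central vertex adjacent to all other vertices and with no other edges. *)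

theory Defs
  imports "HOL-Algebra.AbelCoset" "HOL-Library.Extended_Nat"
begin

text \<open>
  Nearrings are given as the \<^type>\<open>ring_scheme\<close> record of HOL-Algebra; its field for the
  multiplicative unit is left unconstrained, and addition need not commute.
\<close>

locale right_nearring =
  fixes N :: "('a, 'b) ring_scheme" (structure)
  assumes add_group: "group (add_monoid N)"
    and mult_closed: "\<lbrakk>a \<in> carrier N; b \<in> carrier N\<rbrakk> \<Longrightarrow> a \<otimes> b \<in> carrier N"
    and mult_assoc: "\<lbrakk>a \<in> carrier N; b \<in> carrier N; c \<in> carrier N\<rbrakk>
      \<Longrightarrow> (a \<otimes> b) \<otimes> c = a \<otimes> (b \<otimes> c)"
    and right_distrib: "\<lbrakk>a \<in> carrier N; b \<in> carrier N; c \<in> carrier N\<rbrakk>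
      \<Longrightarrow> (a \<oplus> b) \<otimes> c = a \<otimes> c \<oplus> b \<otimes> c"

definition nearring_ideal :: "('a, 'b) ring_scheme \<Rightarrow> 'a set \<Rightarrow> bool" where
  "nearring_ideal N I \<longleftrightarrow>
     I \<lhd> add_monoid N \<and>
     (\<forall>i\<in>I. \<forall>n\<in>carrier N. i \<otimes>\<^bsub>N\<^esub> n \<in> I) \<and>
     (\<forall>n\<in>carrier N. \<forall>n'\<in>carrier N. \<forall>i\<in>I.
        n \<otimes>\<^bsub>N\<^esub> (n' \<oplus>\<^bsub>N\<^esub> i) \<ominus>\<^bsub>N\<^esub> n \<otimes>\<^bsub>N\<^esub> n' \<in> I)"

definition is_supplement :: "('a, 'b) ring_scheme \<Rightarrow> 'a set \<Rightarrow> 'a set \<Rightarrow> bool" where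
  "is_supplement N K I \<longleftrightarrow>
     nearring_ideal N I \<and> K <+>\<^bsub>N\<^esub> I = carrier N \<and>
     (\<forall>J. nearring_ideal N J \<and> K <+>\<^bsub>N\<^esub> J = carrier N \<and> J \<subseteq> I \<longrightarrow> J = I)"

definition supplement_ideal :: "('a, 'b) ring_scheme \<Rightarrow> 'a set \<Rightarrow> bool" where
  "supplement_ideal N I \<longleftrightarrow> (\<exists>K. nearring_ideal N K \<and> is_supplement N K I)"

text \<open>Vertex sets may be infinite.\<close>

record 'v sgraph =
  verts :: "'v set"
  edges :: "'v set set"

definition simple_graph :: "'v sgraph \<Rightarrow> bool" where
  "simple_graph G \<longleftrightarrow> (\<forall>e\<in>edges G. e \<subseteq> verts G \<and> card e = 2)"

text \<open>
  A cycle is given by the list of its distinct vertices in cyclic order, without repeating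
  the first vertex at the end, so its length is the length of the list.
\<close>

definition is_cycle :: "'v sgraph \<Rightarrow> 'v list \<Rightarrow> bool" where
  "is_cycle G vs \<longleftrightarrow>
     3 \<le> length vs \<and> distinct vs \<and> set vs \<subseteq> verts G \<and>
     (\<forall>i<length vs. {vs ! i, vs ! (Suc i mod length vs)} \<in> edges G)"

text \<open>The girth of a graph without cycles is \<^term>\<open>\<infinity> :: enat\<close>, the infimum of the empty set.\<close>

definition girth :: "'v sgraph \<Rightarrow> enat" where
  "girth G = (INF vs \<in> {vs. is_cycle G vs}. enat (length vs))"

text \<open>The one-vertex graph counts as a star.\<close>

definition star_graph :: "'v sgraph \<Rightarrow> bool" where
  "star_graph G \<longleftrightarrow> (\<exists>c\<in>verts G. edges G = {{c, v} | v. v \<in> verts G \<and> v \<noteq> c})"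

definition SIG :: "('a, 'b) ring_scheme \<Rightarrow> 'a set sgraph" where
  "SIG N = \<lparr> verts = {I. nearring_ideal N I},
             edges = {{I, J} | I J. nearring_ideal N I \<and> nearring_ideal N J \<and> I \<noteq> J \<and>
                                    supplement_ideal N (I \<inter> J)} \<rparr>"

lemma simple_graph_SIG: "simple_graph (SIG N)"
  unfolding simple_graph_def
proof
  fix e assume "e \<in> edges (SIG N)"
  then obtain I J where "e = {I, J}" "I \<noteq> J" "nearring_ideal N I" "nearring_ideal N J"
    unfolding SIG_def by auto
  then show "e \<subseteq> verts (SIG N) \<and> card e = 2"
    by (simp add: SIG_def)
qed

lemma SIG_adjacent_iff:
  assumes "nearring_ideal N I" and "nearring_ideal N J"
  shows "{I, J} \<in> edges (SIG N) \<longleftrightarrow> I \<noteq> J \<and> supplement_ideal N (I \<inter> J)"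
  using assms by (auto simp: SIG_def doubleton_eq_iff Int_commute)

end

theory Submission
  imports Defs
begin

text \<open>
  The zero ideal is a supplement of \<open>N\<close> itself, so it is adjacent to every other ideal. Hence any
  edge that avoids it closes up to a triangle, and if there is no such edge the graph is a star
  centred at it.
\<close>

lemma girth_ge_3: "3 \<le> girth G"
  unfolding girth_def
  by (rule INF_greatest) (simp add: is_cycle_def flip: enat_numeral)

lemma girth_eq_3_if_triangle:
  assumes "u \<in> verts G" "v \<in> verts G" "w \<in> verts G" "u \<noteq> v" "v \<noteq> w" "u \<noteq> w"
    and "{u, v} \<in> edges G" "{v, w} \<in> edges G" "{u, w} \<in> edges G"
  shows "girth G = 3"
proof (rule antisym[OF _ girth_ge_3])
  \<comment> \<open>The last index wraps around to the first vertex and asks for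
    \<open>{w, u}\<close>; \<open>insert_commute\<close> matches it with the assumed edge
    \<open>{u, w}\<close>.\<close>
  have "is_cycle G [u, v, w]"
    using assms by (simp add: is_cycle_def All_less_Suc insert_commute[of w u])
  then have "girth G \<le> enat (length [u, v, w])"
    unfolding girth_def by (intro INF_lower) simp
  then show "girth G \<le> 3"
    by (simp add: numeral_eq_enat eval_nat_numeral)
qed

text \<open>Purely graph-theoretic: simplicity makes each edge a pair of distinct vertices, so an
  edge off \<open>c\<close> has two ends that \<open>univ\<close> joins to \<open>c\<close>.\<close>

lemma star_or_girth_3_if_universal:
  assumes "simple_graph G" and "c \<in> verts G"
    and univ: "\<And>v. v \<in> verts G \<Longrightarrow> v \<noteq> c \<Longrightarrow> {c, v} \<in> edges G"
  shows "star_graph G \<or> girth G = 3"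
proof (cases "\<exists>e\<in>edges G. c \<notin> e")
  case True
  then obtain e where e: "e \<in> edges G" "c \<notin> e" by blast
  with \<open>simple_graph G\<close> have "e \<subseteq> verts G" "card e = 2"
    by (auto simp: simple_graph_def)
  then obtain u v where uv: "e = {u, v}" "u \<noteq> v" by (auto simp: card_2_iff)
  with e \<open>e \<subseteq> verts G\<close> have "girth G = 3"
    by (intro girth_eq_3_if_triangle[of c G u v]) (auto intro: univ \<open>c \<in> verts G\<close>)
  then show ?thesis ..
next
  case False
  have "edges G \<subseteq> {{c, v} | v. v \<in> verts G \<and> v \<noteq> c}"
  proof
    fix e assume "e \<in> edges G"
    with \<open>simple_graph G\<close> False have "e \<subseteq> verts G" "card e = 2" "c \<in> e"
      by (auto simp: simple_graph_def)
    then obtain v where "e = {c, v}" "v \<noteq> c"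
      unfolding card_2_iff by blast
    with \<open>e \<subseteq> verts G\<close> show "e \<in> {{c, v} | v. v \<in> verts G \<and> v \<noteq> c}" by blast
  qed
  \<comment> \<open>The converse inclusion is \<open>univ\<close>. If \<open>c\<close> is the only
    vertex, both edge sets are empty.\<close>
  then have "star_graph G"
    using assms unfolding star_graph_def by blast
  then show ?thesis ..
qed

lemma zero_mem_nearring_ideal: "nearring_ideal N I \<Longrightarrow> \<zero>\<^bsub>N\<^esub> \<in> I"
  using subgroup.one_closed[OF normal_imp_subgroup, of I "add_monoid N"]
  by (simp add: nearring_ideal_def)

context right_nearring
begin

text \<open>Only \<open>group\<close>, as addition need not commute; the rewrites restate its facts
  in additive notation.\<close>

interpretation add: group "add_monoid N"
  rewrites "carrier (add_monoid N) = carrier N"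
    and "mult (add_monoid N) = add N"
    and "one (add_monoid N) = zero N"
    and "m_inv (add_monoid N) = a_inv N"
  by (rule add_group) (auto simp: a_inv_def)

text \<open>Cancel in 0n = (0 + 0)n = 0n + 0n. Right distributivity gives no such law for
  n0.\<close>

lemma zero_mult: "n \<in> carrier N \<Longrightarrow> \<zero> \<otimes> n = \<zero>"
  using right_distrib[of \<zero> \<zero> n] add.l_cancel_one[of "\<zero> \<otimes> n" "\<zero> \<otimes> n"]
  by (simp add: mult_closed)

text \<open>Closure under right multiplication is \<open>zero_mult\<close>; the other condition
  reduces to nn' - nn' = 0, so the value of n0 does not matter.\<close>

lemma nearring_ideal_zero: "nearring_ideal N {\<zero>}"
  using add.one_is_normal
  by (auto simp: nearring_ideal_def zero_mult a_minus_def mult_closed)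

lemma nearring_ideal_carrier: "nearring_ideal N (carrier N)"
proof -
  have "carrier N \<lhd> add_monoid N"
    using add.subgroup_self by (auto simp: add.normal_inv_iff)
  then show ?thesis
    by (auto simp: nearring_ideal_def a_minus_def mult_closed)
qed

lemma supplement_ideal_zero: "supplement_ideal N {\<zero>}"
proof -
  have "carrier N <+>\<^bsub>N\<^esub> {\<zero>} = carrier N"
    by (auto simp: set_add_def')
  \<comment> \<open>Minimality: an ideal inside \<open>{\<zero>}\<close> contains
    \<open>\<zero>\<close>, hence equals it.\<close>
  then have "is_supplement N (carrier N) {\<zero>}"
    using zero_mem_nearring_ideal nearring_ideal_zero by (auto simp: is_supplement_def)
  then show ?thesis
    using nearring_ideal_carrier by (auto simp: supplement_ideal_def)
qed

text \<open>Every ideal contains \<open>\<zero>\<close>, so it meets the zero ideal in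
  \<open>{\<zero>}\<close>, a supplement ideal.\<close>

lemma zero_adjacent:
  assumes "nearring_ideal N I" and "I \<noteq> {\<zero>}"
  shows "{{\<zero>}, I} \<in> edges (SIG N)"
proof -
  have "{\<zero>} \<inter> I = {\<zero>}"
    using zero_mem_nearring_ideal[OF assms(1)] by blast
  then show ?thesis
    using assms SIG_adjacent_iff[OF nearring_ideal_zero assms(1)] supplement_ideal_zero by simp
qed

end

theorem lemma4p19:
  fixes N :: "('a, 'b) ring_scheme"
  assumes "right_nearring N"
  shows "star_graph (SIG N) \<or> girth (SIG N) = 3"
proof -
  interpret right_nearring N by (rule assms)
  have "verts (SIG N) = {I. nearring_ideal N I}"
    by (simp add: SIG_def)
  then show ?thesis
    using nearring_ideal_zero zero_adjacent
    by (intro star_or_girth_3_if_universal[of _ "{\<zero>\<^bsub>N\<^esub>}"] simple_graph_SIG) auto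
qed

end
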